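(* Let $G$ be a finite undirected graph (multiple edges and loops allowed), and let $\mathcal I$ denote the collection of ideals of $\mathrm{Fisg}(G)$. Then $\mathcal I$ forms a distributive semimodular lattice under inclusion.
   Context: Graphs are finite and undirected and may have multiple edges and loops; the empty graph $\emptyset$ counts as a graph and the empty map $\mu_0:\emptyset\to\emptyset$ counts as a graph isomorphism. For a graph $G$, $\mathrm{Fisg}(G)$ is the set of all graph isomorphisms $\varphi:H\to J$ (bijections on vertices and on edges preserving incidence) where $H$ and $J$ are subgraphs of $G$. For $\varphi,\psi\in\mathrm{Fisg}(G)$ the product $\psi\circ\varphi$ is the composition of partial maps, with domain $\varphi^{-1}(\mathrm{Im}(\varphi)\cap\mathrm{Dom}(\psi))$ and image $\psi(\mathrm{Im}(\varphi)\cap\mathrm{Dom}(\psi))$. With this product $\mathrm{Fisg}(G)$ is an inverse semigroup. An ideal of a semigroup $S$ is a subset $I\subseteq S$ with $SI\subseteq I$ and $IS\subseteq I$. A lattice is semimodular if, for all $A,B$, whenever $A$ covers $A\wedge B$, then $A\vee B$ covers $B$. *)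

theory Defs
  imports "HOL-Algebra.Lattice" "HOL-Algebra.Coset"
begin

text \<open>An edge is sent to the set of its endpoints, which is a singleton precisely for loops.
  Distinct edges may have the same endpoints.\<close>

record ('v, 'e) ugraph =
  verts :: "'v set"
  edges :: "'e set"
  ends :: "'e \<Rightarrow> 'v set"

definition finite_graph :: "('v, 'e) ugraph \<Rightarrow> bool" where
  "finite_graph G \<longleftrightarrow> finite (verts G) \<and> finite (edges G) \<and>
     (\<forall>e\<in>edges G. ends G e \<subseteq> verts G \<and> (card (ends G e) = 1 \<or> card (ends G e) = 2))"

definition subgraph :: "('v, 'e) ugraph \<Rightarrow> ('v, 'e) ugraph \<Rightarrow> bool" where
  "subgraph H G \<longleftrightarrow> finite_graph H \<and> verts H \<subseteq> verts G \<and> edges H \<subseteq> edges G \<and>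
     (\<forall>e\<in>edges H. ends H e = ends G e)"

text \<open>A map between graphs is a pair of partial functions, on vertices and on edges, defined
  exactly on the source graph. Two partial isomorphisms of a graph are thus equal as pairs iff
  they have the same source and the same values (and then also the same target).\<close>

type_synonym ('v, 'e) graph_map = "('v \<rightharpoonup> 'v) \<times> ('e \<rightharpoonup> 'e)"

definition graph_iso ::
  "('v, 'e) ugraph \<Rightarrow> ('v, 'e) ugraph \<Rightarrow> ('v, 'e) graph_map \<Rightarrow> bool" where
  "graph_iso H J \<phi> \<longleftrightarrow>
     dom (fst \<phi>) = verts H \<and> ran (fst \<phi>) = verts J \<and> inj_on (fst \<phi>) (verts H) \<and>
     dom (snd \<phi>) = edges H \<and> ran (snd \<phi>) = edges J \<and> inj_on (snd \<phi>) (edges H) \<and>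
     (\<forall>e\<in>edges H. ends J (the (snd \<phi> e)) = (\<lambda>v. the (fst \<phi> v)) ` ends H e)"

text \<open>The product \<open>\<psi> \<otimes> \<phi>\<close> means ``first \<open>\<phi>\<close>, then \<open>\<psi>\<close>''. The semigroup is a monoid, whose unit is
  the identity map of the whole graph; the unit only fills the field of the monoid record and
  plays no role for ideals.\<close>

definition Fisg :: "('v, 'e) ugraph \<Rightarrow> ('v, 'e) graph_map monoid" where
  "Fisg G =
     \<lparr>carrier = {\<phi>. \<exists>H J. subgraph H G \<and> subgraph J G \<and> graph_iso H J \<phi>},
      mult = (\<lambda>\<psi> \<phi>. (fst \<psi> \<circ>\<^sub>m fst \<phi>, snd \<psi> \<circ>\<^sub>m snd \<phi>)),
      one = (Some |` verts G, Some |` edges G)\<rparr>"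

text \<open>The empty set counts as an ideal.\<close>

definition semigroup_ideal :: "'a set \<Rightarrow> ('a, 'b) monoid_scheme \<Rightarrow> bool" where
  "semigroup_ideal I S \<longleftrightarrow>
     I \<subseteq> carrier S \<and> carrier S <#>\<^bsub>S\<^esub> I \<subseteq> I \<and> I <#>\<^bsub>S\<^esub> carrier S \<subseteq> I"

definition ideal_order :: "('a, 'b) monoid_scheme \<Rightarrow> 'a set gorder" where
  "ideal_order S = \<lparr>carrier = {I. semigroup_ideal I S}, eq = (=), le = (\<subseteq>)\<rparr>"

definition covers :: "('a, 'b) gorder_scheme \<Rightarrow> 'a \<Rightarrow> 'a \<Rightarrow> bool" where
  "covers L x y \<longleftrightarrow> y \<sqsubset>\<^bsub>L\<^esub> x \<and> \<not> (\<exists>z\<in>carrier L. y \<sqsubset>\<^bsub>L\<^esub> z \<and> z \<sqsubset>\<^bsub>L\<^esub> x)"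

locale distributive_lattice = lattice L for L (structure) +
  assumes meet_join_distrib:
    "\<lbrakk>x \<in> carrier L; y \<in> carrier L; z \<in> carrier L\<rbrakk>
      \<Longrightarrow> x \<sqinter> (y \<squnion> z) = (x \<sqinter> y) \<squnion> (x \<sqinter> z)"

locale semimodular_lattice = lattice L for L (structure) +
  assumes semimodular:
    "\<lbrakk>x \<in> carrier L; y \<in> carrier L; covers L x (x \<sqinter> y)\<rbrakk> \<Longrightarrow> covers L (x \<squnion> y) y"

end

theory Submission
  imports Defs
begin

text \<open>Unions and intersections of ideals of any semigroup are ideals, so the ideals form a
  sublattice of a power set, which gives distributivity. If \<open>Z\<close> lies strictly between \<open>Y\<close> and
  \<open>X \<union> Y\<close>, then \<open>X \<inter> Z\<close> lies strictly between \<open>X \<inter> Y\<close> and \<open>X\<close>, which gives semimodularity.\<close>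

text \<open>\<open><#>\<close> is the union of all elementwise products, so the two inclusions
  become closure conditions on single elements. In this form closure under union and intersection is
  immediate.\<close>

lemma semigroup_ideal_iff:
  "semigroup_ideal I S \<longleftrightarrow>
     I \<subseteq> carrier S \<and> (\<forall>s\<in>carrier S. \<forall>x\<in>I. s \<otimes>\<^bsub>S\<^esub> x \<in> I \<and> x \<otimes>\<^bsub>S\<^esub> s \<in> I)"
  unfolding semigroup_ideal_def set_mult_def by (simp add: UN_subset_iff) blast

lemma semigroup_ideal_Int:
  assumes "semigroup_ideal I S" "semigroup_ideal J S"
  shows "semigroup_ideal (I \<inter> J) S"
  using assms unfolding semigroup_ideal_iff by auto

lemma semigroup_ideal_Un:
  assumes "semigroup_ideal I S" "semigroup_ideal J S"
  shows "semigroup_ideal (I \<union> J) S"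
  using assms unfolding semigroup_ideal_iff by auto

lemma ideal_order_simps [simp]:
  "carrier (ideal_order S) = {I. semigroup_ideal I S}"
  "I \<sqsubseteq>\<^bsub>ideal_order S\<^esub> J \<longleftrightarrow> I \<subseteq> J"
  "(.=\<^bsub>ideal_order S\<^esub>) = (=)"
  by (simp_all add: ideal_order_def)

lemma ideal_order_lless [simp]: "I \<sqsubset>\<^bsub>ideal_order S\<^esub> J \<longleftrightarrow> I \<subset> J"
  by (auto simp: lless_def)

lemma partial_order_ideal_order: "partial_order (ideal_order S)"
  by unfold_locales auto

text \<open>The union is itself an ideal, so no ideal has to be generated from it.\<close>

lemma least_ideal_order_Un:
  assumes "semigroup_ideal I S" "semigroup_ideal J S"
  shows "least (ideal_order S) (I \<union> J) (Upper (ideal_order S) {I, J})"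
  using assms semigroup_ideal_Un[OF assms] unfolding least_def Upper_def by auto

lemma greatest_ideal_order_Int:
  assumes "semigroup_ideal I S" "semigroup_ideal J S"
  shows "greatest (ideal_order S) (I \<inter> J) (Lower (ideal_order S) {I, J})"
  using assms semigroup_ideal_Int[OF assms] unfolding greatest_def Lower_def by auto

lemma lattice_ideal_order: "lattice (ideal_order S)"
proof -
  interpret partial_order "ideal_order S" by (rule partial_order_ideal_order)
  show ?thesis
  proof unfold_locales
    fix I J
    assume "I \<in> carrier (ideal_order S)" "J \<in> carrier (ideal_order S)"
    then have IJ: "semigroup_ideal I S" "semigroup_ideal J S"
      by simp_all
    show "\<exists>K. least (ideal_order S) K (Upper (ideal_order S) {I, J})"
      using least_ideal_order_Un[OF IJ] by blast
    show "\<exists>K. greatest (ideal_order S) K (Lower (ideal_order S) {I, J})"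
      using greatest_ideal_order_Int[OF IJ] by blast
  qed
qed

text \<open>The abstract join is a least upper bound picked by choice; uniqueness of least elements
  identifies it with the union.\<close>

lemma ideal_order_join:
  assumes "semigroup_ideal I S" "semigroup_ideal J S"
  shows "I \<squnion>\<^bsub>ideal_order S\<^esub> J = I \<union> J"
proof -
  interpret lattice "ideal_order S" by (rule lattice_ideal_order)
  show ?thesis
    unfolding join_def
    by (rule least_unique[OF sup_of_two_least least_ideal_order_Un[OF assms]]) (use assms in simp_all)
qed

lemma ideal_order_meet:
  assumes "semigroup_ideal I S" "semigroup_ideal J S"
  shows "I \<sqinter>\<^bsub>ideal_order S\<^esub> J = I \<inter> J"
proof -
  interpret lattice "ideal_order S" by (rule lattice_ideal_order)
  show ?thesis
    unfolding meet_def
    by (rule greatest_unique[OF inf_of_two_greatest greatest_ideal_order_Int[OF assms]]) (use assms in simp_all)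
qed

lemma distributive_lattice_ideal_order: "distributive_lattice (ideal_order S)"
proof -
  interpret lattice "ideal_order S" by (rule lattice_ideal_order)
  show ?thesis
    \<comment> \<open>Distributivity of intersection over union for sets; the closure lemmas supply
      the ideal hypotheses for the nested operations.\<close>
    by unfold_locales
      (auto simp: ideal_order_join ideal_order_meet semigroup_ideal_Un semigroup_ideal_Int)
qed

lemma semimodular_lattice_ideal_order: "semimodular_lattice (ideal_order S)"
proof -
  interpret lattice "ideal_order S" by (rule lattice_ideal_order)
  show ?thesis
  proof unfold_locales
    fix X Y
    assume X: "X \<in> carrier (ideal_order S)" and Y: "Y \<in> carrier (ideal_order S)"
      and "covers (ideal_order S) X (X \<sqinter>\<^bsub>ideal_order S\<^esub> Y)"
    then have cov: "X \<inter> Y \<subset> X"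
      and none: "\<And>Z. semigroup_ideal Z S \<Longrightarrow> \<not> (X \<inter> Y \<subset> Z \<and> Z \<subset> X)"
      by (auto simp: covers_def ideal_order_meet)
    \<comment> \<open>Apply \<open>none\<close> to \<open>X \<inter> Z\<close>. A point of
      \<open>Z\<close> outside \<open>Y\<close> lies in \<open>X\<close>, so
      \<open>X \<inter> Y \<subset> X \<inter> Z\<close>; a point of \<open>X \<union> Y\<close>
      outside \<open>Z\<close> is not in \<open>Y\<close>, so
      \<open>X \<inter> Z \<subset> X\<close>.\<close>
    have "\<not> (Y \<subset> Z \<and> Z \<subset> X \<union> Y)" if "semigroup_ideal Z S" for Z
      using none[OF semigroup_ideal_Int[OF _ that], of X] X by auto
    \<comment> \<open>A point of \<open>X\<close> outside \<open>Y\<close>, given by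
      \<open>cov\<close>, makes \<open>Y \<subset> X \<union> Y\<close> strict.\<close>
    with cov X Y show "covers (ideal_order S) (X \<squnion>\<^bsub>ideal_order S\<^esub> Y) Y"
      by (auto simp: covers_def ideal_order_join)
  qed
qed

theorem theorem4p15:
  fixes G :: "('v, 'e) ugraph"
  assumes "finite_graph G"
  shows "distributive_lattice (ideal_order (Fisg G)) \<and> semimodular_lattice (ideal_order (Fisg G))"
  by (intro conjI distributive_lattice_ideal_order semimodular_lattice_ideal_order)

end
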